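(* Let $N\ge 1$ and let $(a_n)_{n\ge 0}$ (positive) and $(b_n)_{n\ge 0}$ (real) be the Jacobi parameters of a Jacobi matrix $\mathcal{A}$. Suppose they are $N$-periodically modulated with respect to $N$-periodic sequences $(\alpha_n)_{n\ge0}$ (positive) and $(\beta_n)_{n\ge0}$ (real). Suppose that $\operatorname{tr}\mathfrak{X}_N(0)\in\mathbb{R}\setminus[-2,2]$ and that $$\Big(\frac{a_{n-1}}{a_n}\Big),\quad \Big(\frac{b_n}{a_n}\Big),\quad \Big(\frac1{a_n}\Big)\in\mathcal{D}_1^N .$$ Then for every positive sequence $(\rho_n)$ tending to infinity, $\frac1{\rho_n}\nu_n$ converges vaguely to $0$ on $\mathbb{R}$, i.e. $\lim_{n\to\infty}\frac1{\rho_n}\int_{\mathbb{R}} f\,d\nu_n=0$ for every compactly supported continuous $f$ on $\mathbb{R}$.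
   Context: The Jacobi matrix $\mathcal{A}$ is the infinite symmetric tridiagonal matrix with diagonal $b_0,b_1,b_2,\dots$ and off-diagonal $a_0,a_1,a_2,\dots$; $\mathcal{A}_n$ is its upper-left $n\times n$ truncation, and $\nu_n=\sum_{y\in\sigma(\mathcal{A}_{n+1})}\delta_y$, where $\delta_y$ is the Dirac measure at $y$. The parameters are $N$-periodically modulated (with respect to the $N$-periodic sequences $\alpha_n>0$, $\beta_n\in\mathbb{R}$) if $$\lim_{n\to\infty}\Big|\frac{a_{n-1}}{a_n}-\frac{\alpha_{n-1}}{\alpha_n}\Big|=0,\quad \lim_{n\to\infty}\Big|\frac{b_n}{a_n}-\frac{\beta_n}{\alpha_n}\Big|=0,\quad \lim_{n\to\infty}a_n=\infty .$$ For $n\ge1$, $\mathfrak{X}_n(x)=\mathfrak{B}_{n+N-1}(x)\cdots\mathfrak{B}_{n+1}(x)\mathfrak{B}_n(x)$ with $\mathfrak{B}_j(x)=\begin{pmatrix}0&1\\-\frac{\alpha_{j-1}}{\alpha_j}&\frac{x-\beta_j}{\alpha_j}\end{pmatrix}$. A sequence $(x_n)_{n\ge1}$ belongs to $\mathcal{D}_1^N$ if $\sum_{n=1}^\infty|x_{n+N}-x_n|<\infty$. *)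

theory Defs
  imports "HOL-Probability.Probability" "Jordan_Normal_Form.Spectral_Radius"
begin

definition jacobi_entry :: "(nat \<Rightarrow> real) \<Rightarrow> (nat \<Rightarrow> real) \<Rightarrow> nat \<Rightarrow> nat \<Rightarrow> real" where
  "jacobi_entry a b i j =
     (if i = j then b i else if j = Suc i then a i else if i = Suc j then a j else 0)"

definition jacobi_trunc :: "(nat \<Rightarrow> real) \<Rightarrow> (nat \<Rightarrow> real) \<Rightarrow> nat \<Rightarrow> real Matrix.mat" where
  "jacobi_trunc a b n = Matrix.mat n n (\<lambda>(i, j). jacobi_entry a b i j)"

text \<open>The truncation is a real symmetric matrix, so its spectrum is real and the spectrum over
  the field of real numbers is the whole spectrum. Each eigenvalue is counted once.\<close>

definition eigenvalue_measure :: "(nat \<Rightarrow> real) \<Rightarrow> (nat \<Rightarrow> real) \<Rightarrow> nat \<Rightarrow> real measure" where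
  "eigenvalue_measure a b n =
     measure_of UNIV (sets borel)
       (\<lambda>B. \<Sum>y\<in>spectrum (jacobi_trunc a b (n + 1)). emeasure (return borel y) B)"

definition periodic_seq :: "nat \<Rightarrow> (nat \<Rightarrow> real) \<Rightarrow> bool" where
  "periodic_seq N x \<longleftrightarrow> (\<forall>n. x (n + N) = x n)"

text \<open>Here and below, \<open>n - 1\<close> is truncated only at \<open>n = 0\<close>; this affects neither
  the limits nor the class \<open>D1\<close>, whose sequences start at index 1.\<close>

definition periodically_modulated ::
  "(nat \<Rightarrow> real) \<Rightarrow> (nat \<Rightarrow> real) \<Rightarrow> (nat \<Rightarrow> real) \<Rightarrow> (nat \<Rightarrow> real) \<Rightarrow> bool" where
  "periodically_modulated \<alpha> \<beta> a b \<longleftrightarrow>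
     (\<lambda>n. \<bar>a (n - 1) / a n - \<alpha> (n - 1) / \<alpha> n\<bar>) \<longlonglongrightarrow> 0 \<and>
     (\<lambda>n. \<bar>b n / a n - \<beta> n / \<alpha> n\<bar>) \<longlonglongrightarrow> 0 \<and>
     filterlim a at_top sequentially"

definition D1 :: "nat \<Rightarrow> (nat \<Rightarrow> real) set" where
  "D1 N = {x. summable (\<lambda>n. \<bar>x (Suc n + N) - x (Suc n)\<bar>)}"

definition transfer_matrix ::
  "(nat \<Rightarrow> real) \<Rightarrow> (nat \<Rightarrow> real) \<Rightarrow> nat \<Rightarrow> real \<Rightarrow> real^2^2" where
  "transfer_matrix \<alpha> \<beta> j x =
     vector [vector [0, 1],
             vector [- (\<alpha> (j - 1) / \<alpha> j), (x - \<beta> j) / \<alpha> j]]"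

text \<open>The product of the \<open>k\<close> transfer matrices with indices \<open>n + k - 1, \<dots>, n\<close>,
  in this order from left to right.\<close>

primrec transfer_product ::
  "(nat \<Rightarrow> real) \<Rightarrow> (nat \<Rightarrow> real) \<Rightarrow> nat \<Rightarrow> real \<Rightarrow> nat \<Rightarrow> real^2^2" where
  "transfer_product \<alpha> \<beta> n x 0 = Finite_Cartesian_Product.mat 1"
| "transfer_product \<alpha> \<beta> n x (Suc k) =
     transfer_matrix \<alpha> \<beta> (n + k) x ** transfer_product \<alpha> \<beta> n x k"

definition monodromy ::
  "nat \<Rightarrow> (nat \<Rightarrow> real) \<Rightarrow> (nat \<Rightarrow> real) \<Rightarrow> nat \<Rightarrow> real \<Rightarrow> real^2^2" where
  "monodromy N \<alpha> \<beta> n x = transfer_product \<alpha> \<beta> n x N"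

definition vaguely_converges :: "(nat \<Rightarrow> real measure) \<Rightarrow> real measure \<Rightarrow> bool" where
  "vaguely_converges \<mu> \<mu>' \<longleftrightarrow>
     (\<forall>f::real \<Rightarrow> real. continuous_on UNIV f \<longrightarrow> compact (closure {x. f x \<noteq> 0}) \<longrightarrow>
        (\<lambda>n. integral\<^sup>L (\<mu> n) f) \<longlonglongrightarrow> integral\<^sup>L \<mu>' f)"

lemma finite_spectrum_jacobi_trunc: "finite (spectrum (jacobi_trunc a b n))"
  by (rule card_finite_spectrum(1)[of _ n]) (simp add: jacobi_trunc_def)

lemma sets_eigenvalue_measure [measurable_cong, simp]:
  "sets (eigenvalue_measure a b n) = sets borel"
  unfolding eigenvalue_measure_def
  by (metis sets.sets_measure_of_eq space_borel)

lemma space_eigenvalue_measure [simp]: "space (eigenvalue_measure a b n) = UNIV"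
  unfolding eigenvalue_measure_def by (rule space_measure_of) auto

lemma emeasure_eigenvalue_measure:
  assumes "B \<in> sets borel"
  shows "emeasure (eigenvalue_measure a b n) B =
           (\<Sum>y\<in>spectrum (jacobi_trunc a b (n + 1)). emeasure (return borel y) B)"
proof (rule emeasure_measure_of[OF eigenvalue_measure_def])
  let ?S = "spectrum (jacobi_trunc a b (n + 1))"
  let ?m = "\<lambda>B. \<Sum>y\<in>?S. emeasure (return borel y) B"
  show "positive (sets (eigenvalue_measure a b n)) ?m"
    by (simp add: positive_def)
  show "countably_additive (sets (eigenvalue_measure a b n)) ?m"
  proof (rule countably_additiveI)
    fix A :: "nat \<Rightarrow> real set"
    assume "range A \<subseteq> sets (eigenvalue_measure a b n)" "disjoint_family A"
    hence "(\<Sum>i. emeasure (return borel y) (A i)) = emeasure (return borel y) (\<Union>i. A i)" for y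
      by (intro suminf_emeasure) auto
    thus "(\<Sum>i. ?m (A i)) = ?m (\<Union>i. A i)"
      by (subst suminf_sum) (auto intro!: summableI)
  qed
qed (use assms in auto)

lemma integral_eigenvalue_measure:
  fixes f :: "real \<Rightarrow> real"
  assumes [measurable]: "f \<in> borel_measurable borel"
  shows "integral\<^sup>L (eigenvalue_measure a b n) f =
           (\<Sum>y\<in>spectrum (jacobi_trunc a b (n + 1)). f y)"
proof -
  let ?S = "spectrum (jacobi_trunc a b (n + 1))"
  have fin: "finite ?S" by (rule finite_spectrum_jacobi_trunc)
  have "eigenvalue_measure a b n = distr (count_space ?S) borel (\<lambda>y. y)"
  proof (rule measure_eqI)
    fix B assume "B \<in> sets (eigenvalue_measure a b n)"
    hence B: "B \<in> sets borel" by simp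
    have "(\<Sum>y\<in>?S. emeasure (return borel y) B) = (\<Sum>y\<in>?S. indicator B y)"
      using B by (simp add: emeasure_return)
    also have "\<dots> = of_nat (card (B \<inter> ?S))"
      using fin by (simp add: indicator_def sum.If_cases Int_commute)
    finally show "emeasure (eigenvalue_measure a b n) B =
        emeasure (distr (count_space ?S) borel (\<lambda>y. y)) B"
      using B fin by (simp add: emeasure_eigenvalue_measure emeasure_distr emeasure_count_space)
  qed simp
  thus ?thesis
    using fin by (simp add: integral_distr lebesgue_integral_count_space_finite)
qed

lemma vaguely_converges_null_iff:
  assumes "\<And>n. \<rho> n > 0"
  shows "vaguely_converges (\<lambda>n. scale_measure (ennreal (1 / \<rho> n)) (eigenvalue_measure a b n))
           (null_measure borel) \<longleftrightarrow>
         (\<forall>f::real \<Rightarrow> real. continuous_on UNIV f \<longrightarrow> compact (closure {x. f x \<noteq> 0}) \<longrightarrow>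
            (\<lambda>n. 1 / \<rho> n * integral\<^sup>L (eigenvalue_measure a b n) f) \<longlonglongrightarrow> 0)"
proof -
  have "integral\<^sup>L (scale_measure (ennreal (1 / \<rho> n)) (eigenvalue_measure a b n)) f =
        1 / \<rho> n * integral\<^sup>L (eigenvalue_measure a b n) f"
    if f: "continuous_on UNIV f" for f :: "real \<Rightarrow> real" and n
  proof -
    have [measurable]: "f \<in> borel_measurable borel"
      using f by (rule borel_measurable_continuous_onI)
    have "scale_measure (ennreal (1 / \<rho> n)) (eigenvalue_measure a b n) =
          density (eigenvalue_measure a b n) (\<lambda>_. ennreal (1 / \<rho> n))"
      by (rule measure_eqI) (auto simp: emeasure_density nn_integral_cmult_indicator)
    thus ?thesis
      using assms[of n] by (simp add: integral_density less_imp_le)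
  qed
  moreover have "integral\<^sup>L (null_measure borel) f = 0" for f :: "real \<Rightarrow> real"
    by (rule integral_eq_zero_AE, rule AE_I[where N = UNIV]) auto
  ultimately show ?thesis unfolding vaguely_converges_def by simp
qed

end

theory Submission
  imports Defs
begin

text \<open>
The number of eigenvalues of the truncations in a fixed compact interval \<open>{-R..R}\<close> is bounded,
uniformly in the size of the truncation. The integral of a test function supported in that interval
is then bounded in \<open>n\<close>, and dividing it by \<open>\<rho> n \<rightarrow> \<infinity>\<close> gives 0.

The uniform bound has two sources. The first is a lower bound for the Jacobi matrix on sequences
supported far out: for a suitable \<open>M\<close>, every finitely supported \<open>v\<close> vanishing on \<open>{..M}\<close> satisfies
\<open>\<parallel>A v\<parallel>\<^sup>2 \<ge> (R\<^sup>2 + 1) * \<parallel>v\<parallel>\<^sup>2\<close> (\<open>tail_coercive\<close>). After division of row \<open>j\<close> by \<open>a j\<close> the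
matrix is, far out, a small perturbation of the periodic recurrence at spectral parameter 0. The
monodromy matrix \<open>X\<close> of that recurrence has determinant 1 and trace \<open>t\<close> with \<open>\<bar>t\<bar> > 2\<close>, and
Cayley-Hamilton turns the recurrence into \<open>v (j + 2 * N) - t * v (j + N) + v j = 0\<close>, where the middle
term dominates the two others in \<open>\<ell>\<^sup>2\<close>; this bounds \<open>\<parallel>v\<parallel>\<close> by a multiple of the norm of the defects
(\<open>periodic_coercive\<close>). As \<open>a j \<rightarrow> \<infinity>\<close>, undoing the division makes the constant arbitrarily large.

The second source is linear algebra (\<open>card_spectrum_le\<close>). More than \<open>M + 2\<close> eigenvalues in
\<open>{-R..R}\<close> would allow a nonzero combination \<open>v\<close> of their eigenvectors to vanish on \<open>{..M}\<close> and at the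
last index. The truncated and the infinite matrix agree on \<open>v\<close>, and orthogonality of the eigenvectors
gives \<open>\<parallel>A v\<parallel> \<le> R * \<parallel>v\<parallel>\<close>, against the lower bound.
\<close>

section \<open>The recurrence at spectral parameter zero\<close>

text \<open>The Cayley-Hamilton identity. Only the trace and the determinant of the matrix enter; for monodromy
matrices both are independent of the index at which the period starts.\<close>

lemma cayley_hamilton_2:
  fixes A :: "real^2^2"
  shows "A *v (A *v x) - trace A *\<^sub>R (A *v x) + Determinants.det A *\<^sub>R x = 0"
  unfolding Finite_Cartesian_Product.vec_eq_iff
  by (simp add: forall_2 matrix_vector_mult_def sum_2 det_2 trace_def algebra_simps)

text \<open>The defect of \<open>v\<close> as a solution, at spectral parameter 0, of the periodic three-term recurrence,
normalised so that \<open>v (Suc j)\<close> has coefficient 1. At index 0 the truncated \<open>j - 1\<close> makes the formula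
meaningless as a recurrence, but it vanishes there for the sequences considered, which start with
zeros.\<close>

definition residual :: "(nat \<Rightarrow> real) \<Rightarrow> (nat \<Rightarrow> real) \<Rightarrow> (nat \<Rightarrow> real) \<Rightarrow> nat \<Rightarrow> real" where
  "residual \<alpha> \<beta> v j = v (Suc j) + \<beta> j / \<alpha> j * v j + \<alpha> (j - 1) / \<alpha> j * v (j - 1)"

definition state :: "(nat \<Rightarrow> real) \<Rightarrow> nat \<Rightarrow> real^2" where
  "state v j = vector [v (j - 1), v j]"

lemma state_Suc:
  assumes "1 \<le> j"
  shows "state v (Suc j) =
    transfer_matrix \<alpha> \<beta> j 0 *v state v j + residual \<alpha> \<beta> v j *\<^sub>R vector [0, 1]"
  unfolding Finite_Cartesian_Product.vec_eq_iff
  by (simp add: forall_2 matrix_vector_mult_def sum_2 state_def residual_def transfer_matrix_def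
      algebra_simps)

lemma norm_transfer_product_le:
  assumes K: "\<And>j x. 1 \<le> j \<Longrightarrow> norm (transfer_matrix \<alpha> \<beta> j 0 *v x) \<le> K * norm x"
    and "0 \<le> K" "1 \<le> j"
  shows "norm (transfer_product \<alpha> \<beta> j 0 k *v x) \<le> K ^ k * norm x"
proof (induction k)
  case (Suc k)
  have "norm (transfer_product \<alpha> \<beta> j 0 (Suc k) *v x)
      \<le> K * norm (transfer_product \<alpha> \<beta> j 0 k *v x)"
    using K[of "j + k"] \<open>1 \<le> j\<close> by (simp flip: matrix_vector_mul_assoc)
  also have "\<dots> \<le> K * (K ^ k * norm x)"
    using Suc \<open>0 \<le> K\<close> by (rule mult_left_mono)
  finally show ?case by (simp add: mult.assoc)
qed simp

lemma norm_vector_0_1 [simp]: "norm (vector [0, 1] :: real^2) = 1"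
  by (simp add: norm_vec_def L2_set_def sum_2)

text \<open>Duhamel's principle for the recurrence: a defect created at \<open>j + i\<close> is transported to \<open>j + k\<close> by at
most \<open>k\<close> transfer matrices, each of norm at most \<open>K\<close>.\<close>

lemma norm_state_defect_le:
  assumes K: "\<And>j x. 1 \<le> j \<Longrightarrow> norm (transfer_matrix \<alpha> \<beta> j 0 *v x) \<le> K * norm x"
    and "1 \<le> K" "1 \<le> j"
  shows "norm (state v (j + k) - transfer_product \<alpha> \<beta> j 0 k *v state v j)
    \<le> K ^ k * (\<Sum>i<k. \<bar>residual \<alpha> \<beta> v (j + i)\<bar>)"
proof (induction k)
  case (Suc k)
  let ?P = "transfer_product \<alpha> \<beta> j 0 k" and ?B = "transfer_matrix \<alpha> \<beta> (j + k) 0"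
  let ?r = "\<lambda>i. residual \<alpha> \<beta> v (j + i)"
  have "state v (j + Suc k) - transfer_product \<alpha> \<beta> j 0 (Suc k) *v state v j
      = ?B *v (state v (j + k) - ?P *v state v j) + ?r k *\<^sub>R vector [0, 1]"
    using state_Suc[of "j + k" v \<alpha> \<beta>] \<open>1 \<le> j\<close>
    by (simp add: matrix_vector_mult_diff_distrib flip: matrix_vector_mul_assoc)
  also have "norm \<dots> \<le> K * norm (state v (j + k) - ?P *v state v j) + \<bar>?r k\<bar>"
    by (rule norm_triangle_mono) (use K[of "j + k"] \<open>1 \<le> j\<close> in auto)
  also have "\<dots> \<le> K * (K ^ k * (\<Sum>i<k. \<bar>?r i\<bar>)) + K ^ Suc k * \<bar>?r k\<bar>"
  proof (rule add_mono)
    show "\<bar>?r k\<bar> \<le> K ^ Suc k * \<bar>?r k\<bar>"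
      using mult_right_mono[OF one_le_power[OF \<open>1 \<le> K\<close>, of "Suc k"], of "\<bar>?r k\<bar>"] by simp
  qed (use Suc \<open>1 \<le> K\<close> in \<open>auto intro: mult_left_mono\<close>)
  finally show ?case by (simp add: algebra_simps)
qed simp

section \<open>Monodromy matrices of a periodic recurrence\<close>

lemma det_transfer_matrix: "Determinants.det (transfer_matrix \<alpha> \<beta> j x) = \<alpha> (j - 1) / \<alpha> j"
  by (simp add: transfer_matrix_def det_2)

text \<open>The determinants \<open>\<alpha> (i - 1) / \<alpha> i\<close> telescope; over a full period the product is 1.\<close>

lemma det_transfer_product:
  assumes \<alpha>_pos: "\<And>n. 0 < \<alpha> n" and "1 \<le> j"
  shows "Determinants.det (transfer_product \<alpha> \<beta> j x k) = \<alpha> (j - 1) / \<alpha> (j + k - 1)"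
proof (induction k)
  case 0
  then show ?case using \<alpha>_pos[of "j - 1"] by simp
next
  case (Suc k)
  then show ?case
    using assms(2) \<alpha>_pos[of "j + k - 1"] by (simp add: det_mul det_transfer_matrix)
qed

lemma transfer_product_shift:
  "transfer_product \<alpha> \<beta> (Suc j) x k ** transfer_matrix \<alpha> \<beta> j x =
   transfer_product \<alpha> \<beta> j x (Suc k)"
proof (induction k)
  case (Suc k)
  have "transfer_product \<alpha> \<beta> (Suc j) x (Suc k) ** transfer_matrix \<alpha> \<beta> j x
      = transfer_matrix \<alpha> \<beta> (Suc j + k) x **
        (transfer_product \<alpha> \<beta> (Suc j) x k ** transfer_matrix \<alpha> \<beta> j x)"
    by (simp add: matrix_mul_assoc)
  then show ?case using Suc by simp
qed simp

context
  fixes N :: nat and \<alpha> \<beta> :: "nat \<Rightarrow> real"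
  assumes N: "1 \<le> N"
    and \<alpha>_pos: "\<And>n. 0 < \<alpha> n"
    and \<alpha>_per: "periodic_seq N \<alpha>" and \<beta>_per: "periodic_seq N \<beta>"
begin

lemma transfer_matrix_periodic:
  assumes "1 \<le> j"
  shows "transfer_matrix \<alpha> \<beta> (j + N) x = transfer_matrix \<alpha> \<beta> j x"
proof -
  obtain i where "j = Suc i" using assms by (cases j) auto
  then show ?thesis
    using \<alpha>_per \<beta>_per by (simp add: transfer_matrix_def periodic_seq_def flip: add_Suc)
qed

lemma transfer_product_periodic:
  assumes "1 \<le> j"
  shows "transfer_product \<alpha> \<beta> (j + N) x k = transfer_product \<alpha> \<beta> j x k"
proof (induction k)
  case (Suc k)
  have "transfer_matrix \<alpha> \<beta> (j + N + k) x = transfer_matrix \<alpha> \<beta> (j + k) x"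
    using transfer_matrix_periodic[of "j + k"] assms by (simp add: ac_simps)
  then show ?case using Suc by simp
qed simp

lemma det_monodromy:
  assumes "1 \<le> j"
  shows "Determinants.det (monodromy N \<alpha> \<beta> j x) = 1"
proof -
  obtain i where "j = Suc i" using assms by (cases j) auto
  then show ?thesis
    using \<alpha>_per \<alpha>_pos[of i]
    by (simp add: monodromy_def det_transfer_product[OF \<alpha>_pos] periodic_seq_def)
qed

text \<open>Moving the starting index by one conjugates the monodromy matrix by a transfer matrix, because the
factor that enters on the left equals, by periodicity, the one that leaves on the right.\<close>

lemma trace_monodromy_Suc:
  assumes "1 \<le> j"
  shows "trace (monodromy N \<alpha> \<beta> (Suc j) x) = trace (monodromy N \<alpha> \<beta> j x)"
proof -
  let ?B = "transfer_matrix \<alpha> \<beta> j x"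
  let ?X = "monodromy N \<alpha> \<beta> j x" and ?Y = "monodromy N \<alpha> \<beta> (Suc j) x"
  have "Determinants.det ?B \<noteq> 0"
    using \<alpha>_pos by (metis det_transfer_matrix divide_eq_0_iff less_irrefl)
  then obtain C where C: "?B ** C = Finite_Cartesian_Product.mat 1"
      "C ** ?B = Finite_Cartesian_Product.mat 1"
    using invertible_det_nz unfolding invertible_def by blast
  have shift: "?Y ** ?B = ?B ** ?X"
    using assms by (simp add: monodromy_def transfer_product_shift transfer_matrix_periodic)
  have "?Y = ?B ** (?X ** C)"
    by (metis C(1) matrix_mul_assoc matrix_mul_rid shift)
  then have "trace ?Y = trace (?B ** (?X ** C))" by (rule arg_cong)
  also have "\<dots> = trace ((?X ** C) ** ?B)" by (rule trace_mul_sym)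
  also have "(?X ** C) ** ?B = ?X ** (C ** ?B)" by (rule matrix_mul_assoc[symmetric])
  also have "\<dots> = ?X" by (simp add: C(2))
  finally show ?thesis .
qed

lemma trace_monodromy:
  assumes "1 \<le> j"
  shows "trace (monodromy N \<alpha> \<beta> j x) = trace (monodromy N \<alpha> \<beta> N x)"
proof -
  have *: "trace (monodromy N \<alpha> \<beta> j x) = trace (monodromy N \<alpha> \<beta> 1 x)" if "1 \<le> j" for j
    using that by (induction j rule: dec_induct) (auto simp: trace_monodromy_Suc)
  show ?thesis using *[OF assms] *[OF N] by simp
qed

text \<open>By periodicity only \<open>N\<close> different matrices occur, so the sum of their norms is a common bound.\<close>

lemma transfer_matrix_bounded:
  obtains K where "1 \<le> K" "\<And>j x. 1 \<le> j \<Longrightarrow> norm (transfer_matrix \<alpha> \<beta> j 0 *v x) \<le> K * norm x"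
proof -
  let ?o = "\<lambda>j. onorm ((*v) (transfer_matrix \<alpha> \<beta> j 0))"
  define K where "K = 1 + (\<Sum>j\<in>{1..N}. ?o j)"
  have o_nonneg: "0 \<le> ?o j" for j by (simp add: onorm_pos_le)
  have o_le: "?o j \<le> K" if "1 \<le> j" for j
    using that
  proof (induction j rule: less_induct)
    case (less j)
    show ?case
    proof (cases "j \<le> N")
      case True
      then have "?o j \<le> (\<Sum>j\<in>{1..N}. ?o j)"
        using less.prems by (intro member_le_sum) (auto simp: o_nonneg)
      then show ?thesis by (simp add: K_def)
    next
      case False
      then have "?o (j - N) \<le> K" using less N by simp
      then show ?thesis using transfer_matrix_periodic[of "j - N" 0] False by simp
    qed
  qed
  show ?thesis
  proof (rule that)
    show "1 \<le> K" by (simp add: K_def sum_nonneg o_nonneg)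
    fix j :: nat and x assume "1 \<le> j"
    have "norm (transfer_matrix \<alpha> \<beta> j 0 *v x) \<le> ?o j * norm x"
      by (rule onorm) simp
    also have "\<dots> \<le> K * norm x" using o_le[OF \<open>1 \<le> j\<close>] by (rule mult_right_mono) simp
    finally show "norm (transfer_matrix \<alpha> \<beta> j 0 *v x) \<le> K * norm x" .
  qed
qed

subsection \<open>Lower bound for hyperbolic periodic recurrences\<close>

text \<open>For an exact solution of the periodic recurrence the state after one period is \<open>X w\<close> and after two
periods \<open>X (X w)\<close>, where \<open>X\<close> has determinant 1 and trace \<open>t\<close>. Cayley-Hamilton then gives
\<open>v (j + 2 * N) - t * v (j + N) + v j = 0\<close>: the recurrence with periodic coefficients implies a
recurrence with the constant coefficients \<open>1, -t, 1\<close>. For an arbitrary sequence the same combination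
is controlled by the defects in the two periods involved.\<close>

lemma two_period_combination_le:
  obtains D where "0 < D" "\<And>v j. 1 \<le> j \<Longrightarrow>
    \<bar>v (j + 2 * N) - trace (monodromy N \<alpha> \<beta> N 0) * v (j + N) + v j\<bar>
      \<le> D * (\<Sum>i<2 * N. \<bar>residual \<alpha> \<beta> v (j + i)\<bar>)"
proof -
  obtain K where "1 \<le> K"
    and K: "\<And>j x. 1 \<le> j \<Longrightarrow> norm (transfer_matrix \<alpha> \<beta> j 0 *v x) \<le> K * norm x"
    using transfer_matrix_bounded by blast
  define t where "t = trace (monodromy N \<alpha> \<beta> N 0)"
  define D where "D = (K ^ N + \<bar>t\<bar> + 1) * K ^ N"
  have "0 < K ^ N" using \<open>1 \<le> K\<close> by simp
  show ?thesis
  proof (rule that[of D])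
    show "0 < D" using \<open>0 < K ^ N\<close> by (simp add: D_def add_pos_nonneg)
    fix v :: "nat \<Rightarrow> real" and j :: nat assume j: "1 \<le> j"
    let ?X = "monodromy N \<alpha> \<beta> j 0" and ?r = "\<lambda>i. residual \<alpha> \<beta> v (j + i)"
    have two: "j + 2 * N = N + (N + j)" by simp
    define d where "d = state v (j + N) - ?X *v state v j"
    define d' where "d' = state v (j + 2 * N) - ?X *v state v (j + N)"
    let ?s = "\<Sum>i<N. \<bar>?r i\<bar>" and ?s' = "\<Sum>i<N. \<bar>?r (i + N)\<bar>"
    have d: "norm d \<le> K ^ N * ?s"
      using norm_state_defect_le[OF K \<open>1 \<le> K\<close> j, of v N] by (simp add: d_def monodromy_def)
    have d': "norm d' \<le> K ^ N * ?s'"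
      using norm_state_defect_le[OF K \<open>1 \<le> K\<close>, of "j + N" v N] j
        transfer_product_periodic[OF j, of 0 N]
      unfolding d'_def monodromy_def two by (simp add: ac_simps)
    have s: "0 \<le> ?s" "0 \<le> ?s'" by (auto intro: sum_nonneg)
    \<comment> \<open>The trace and the determinant of \<open>?X\<close> do not depend on \<open>j\<close>, so \<open>t\<close> serves every \<open>j\<close>.\<close>
    have "?X *v (?X *v state v j) - t *\<^sub>R (?X *v state v j) + state v j = 0"
      using cayley_hamilton_2[of ?X "state v j"] j
      by (simp add: det_monodromy trace_monodromy t_def)
    then have "state v (j + 2 * N) - t *\<^sub>R state v (j + N) + state v j = ?X *v d + d' - t *\<^sub>R d"
      by (simp add: d_def d'_def matrix_vector_mult_diff_distrib algebra_simps)
    also have "norm \<dots> \<le> norm (?X *v d) + norm d' + norm (t *\<^sub>R d)"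
      by (meson norm_triangle_ineq4 norm_triangle_ineq add_right_mono order_trans)
    also have "\<dots> \<le> K ^ N * norm d + K ^ N * ?s' + \<bar>t\<bar> * norm d"
      using norm_transfer_product_le[OF K _ j, of N d] d' \<open>1 \<le> K\<close>
      by (simp add: monodromy_def)
    also have "\<dots> = (K ^ N + \<bar>t\<bar>) * norm d + K ^ N * ?s'"
      by (simp add: algebra_simps)
    also have "\<dots> \<le> (K ^ N + \<bar>t\<bar>) * (K ^ N * ?s) + K ^ N * ?s'"
      using d \<open>0 < K ^ N\<close> by (simp add: mult_left_mono)
    also have "\<dots> \<le> D * (?s + ?s')"
    proof -
      have "(K ^ N + \<bar>t\<bar>) * (K ^ N * ?s) \<le> D * ?s"
        unfolding D_def mult.assoc using \<open>0 < K ^ N\<close> s by (intro mult_right_mono) auto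
      moreover have "1 * (K ^ N * ?s') \<le> D * ?s'"
        unfolding D_def mult.assoc using \<open>0 < K ^ N\<close> s by (intro mult_right_mono) auto
      ultimately show ?thesis by (simp add: distrib_left)
    qed
    also have "?s + ?s' = (\<Sum>i<2 * N. \<bar>?r i\<bar>)"
      using sum.atLeastLessThan_concat[of 0 N "2 * N" "\<lambda>i. \<bar>?r i\<bar>"]
        sum.shift_bounds_nat_ivl[of "\<lambda>i. \<bar>?r i\<bar>" 0 N N]
      by (simp add: atLeast0LessThan mult_2)
    finally have le: "norm (state v (j + 2 * N) - t *\<^sub>R state v (j + N) + state v j)
        \<le> D * (\<Sum>i<2 * N. \<bar>?r i\<bar>)" .
    have "\<bar>v (j + 2 * N) - t * v (j + N) + v j\<bar>
        \<le> norm (state v (j + 2 * N) - t *\<^sub>R state v (j + N) + state v j)"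
      using component_le_norm_cart[of "state v (j + 2 * N) - t *\<^sub>R state v (j + N) + state v j" 2]
      by (simp add: state_def)
    with le show "\<bar>v (j + 2 * N) - trace (monodromy N \<alpha> \<beta> N 0) * v (j + N) + v j\<bar>
        \<le> D * (\<Sum>i<2 * N. \<bar>?r i\<bar>)" by (simp add: t_def)
  qed
qed

text \<open>Finite sums of squares serve as squared \<open>\<ell>\<^sup>2\<close> norms of finitely supported sequences. Shifting
towards 0 only drops entries, so it does not increase such a norm.\<close>

lemma shifted_sum_le:
  fixes f :: "nat \<Rightarrow> real"
  assumes nonneg: "\<And>i. 0 \<le> f i" and vanish: "\<And>i. n \<le> i \<Longrightarrow> f i = 0"
  shows "(\<Sum>j<L. f (j + k)) \<le> (\<Sum>i<n. f i)"
proof -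
  have "(\<Sum>j<L. f (j + k)) = (\<Sum>i\<in>(\<lambda>j. j + k) ` {..<L}. f i)"
    by (subst sum.reindex) (auto simp: inj_on_def)
  also have "\<dots> = (\<Sum>i\<in>(\<lambda>j. j + k) ` {..<L} \<inter> {..<n}. f i)"
    by (rule sum.mono_neutral_right) (auto intro: vanish)
  also have "\<dots> \<le> (\<Sum>i<n. f i)"
    by (rule sum_mono2) (auto intro: nonneg)
  finally show ?thesis .
qed

text \<open>Hyperbolicity makes the periodic operator bounded below on \<open>\<ell>\<^sup>2\<close>. In the constant-coefficient
recurrence of the previous lemma the middle term dominates: shifts do not increase the norm, so
\<open>\<bar>t\<bar> * \<parallel>v\<parallel> \<le> 2 * \<parallel>v\<parallel> + \<parallel>e\<parallel>\<close> with an error \<open>e\<close> bounded by the defects, and \<open>\<bar>t\<bar> > 2\<close>.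
The zeros at the start of \<open>v\<close> ensure that the shift by \<open>N\<close> loses no part of the norm.\<close>

lemma periodic_coercive:
  assumes hyperbolic: "trace (monodromy N \<alpha> \<beta> N 0) \<notin> {-2..2}"
  obtains C where "0 < C" "\<And>v n. (\<And>j. j \<le> N \<Longrightarrow> v j = 0) \<Longrightarrow> (\<And>j. n \<le> j \<Longrightarrow> v j = 0) \<Longrightarrow>
    (\<Sum>j<n. (v j)\<^sup>2) \<le> C * (\<Sum>j<Suc n. (residual \<alpha> \<beta> v j)\<^sup>2)"
proof -
  obtain D where "0 < D" and D: "\<And>v j. 1 \<le> j \<Longrightarrow>
    \<bar>v (j + 2 * N) - trace (monodromy N \<alpha> \<beta> N 0) * v (j + N) + v j\<bar>
      \<le> D * (\<Sum>i<2 * N. \<bar>residual \<alpha> \<beta> v (j + i)\<bar>)"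
    using two_period_combination_le by blast
  define t where "t = trace (monodromy N \<alpha> \<beta> N 0)"
  define \<delta> where "\<delta> = \<bar>t\<bar> - 2"
  have "0 < \<delta>" using hyperbolic by (auto simp: \<delta>_def t_def)
  define C where "C = (D * (2 * real N) / \<delta>)\<^sup>2"
  show ?thesis
  proof (rule that[of C])
    show "0 < C" using \<open>0 < \<delta>\<close> \<open>0 < D\<close> N by (simp add: C_def)
    fix v :: "nat \<Rightarrow> real" and n
    assume low: "\<And>j. j \<le> N \<Longrightarrow> v j = 0" and high: "\<And>j. n \<le> j \<Longrightarrow> v j = 0"
    define S where "S = (\<Sum>j<n. (v j)\<^sup>2)"
    let ?r = "residual \<alpha> \<beta> v"
    define R where "R = (\<Sum>j<Suc n. (?r j)\<^sup>2)"
    define e where "e j = v (j + 2 * N) - t * v (j + N) + v j" for j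
    have shift_le: "(\<Sum>j<n. (v (j + k))\<^sup>2) \<le> S" for k
      unfolding S_def by (rule shifted_sum_le) (auto simp: high)
    have shift_eq: "(\<Sum>j<n. (v (Suc j + N))\<^sup>2) = S"
    proof -
      have "S = (\<Sum>j<n + Suc N. (v j)\<^sup>2)"
        unfolding S_def by (rule sum.mono_neutral_left) (auto simp: high)
      also have "\<dots> = (\<Sum>j\<in>{Suc N..<n + Suc N}. (v j)\<^sup>2)"
        by (rule sum.mono_neutral_right) (auto simp: low not_le)
      also have "\<dots> = (\<Sum>j<n. (v (Suc j + N))\<^sup>2)"
        using sum.shift_bounds_nat_ivl[of "\<lambda>j. (v j)\<^sup>2" 0 "Suc N" n]
        by (simp add: atLeast0LessThan)
      finally show ?thesis by simp
    qed
    have e_sq: "(\<Sum>j<n. (e (Suc j))\<^sup>2) \<le> (D * (2 * real N))\<^sup>2 * R"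
    proof -
      have "(e (Suc j))\<^sup>2 \<le> D\<^sup>2 * (2 * real N) * (\<Sum>i<2 * N. (?r (j + Suc i))\<^sup>2)" for j
      proof -
        have "(e (Suc j))\<^sup>2 \<le> (D * (\<Sum>i<2 * N. \<bar>?r (Suc j + i)\<bar>))\<^sup>2"
          using D[of "Suc j" v] by (subst abs_le_square_iff[symmetric])
            (auto simp: e_def t_def intro: order_trans[OF _ abs_ge_self])
        also have "\<dots> = D\<^sup>2 * (\<Sum>i<2 * N. \<bar>?r (j + Suc i)\<bar>)\<^sup>2"
          by (simp add: power_mult_distrib)
        also have "\<dots> \<le> D\<^sup>2 * ((2 * real N) * (\<Sum>i<2 * N. (?r (j + Suc i))\<^sup>2))"
          using sum_squared_le_sum_of_squares[of "\<lambda>i. \<bar>?r (j + Suc i)\<bar>" "{..<2 * N}"]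
          by (intro mult_left_mono) (auto simp: mult.commute)
        finally show ?thesis by (simp add: mult.assoc)
      qed
      then have "(\<Sum>j<n. (e (Suc j))\<^sup>2)
          \<le> (\<Sum>j<n. D\<^sup>2 * (2 * real N) * (\<Sum>i<2 * N. (?r (j + Suc i))\<^sup>2))"
        by (rule sum_mono)
      also have "\<dots> = D\<^sup>2 * (2 * real N) * (\<Sum>i<2 * N. \<Sum>j<n. (?r (j + Suc i))\<^sup>2)"
        by (subst sum.swap) (simp add: sum_distrib_left)
      also have "\<dots> \<le> D\<^sup>2 * (2 * real N) * (\<Sum>i<2 * N. R)"
      proof (intro mult_left_mono sum_mono)
        show "(\<Sum>j<n. (?r (j + Suc i))\<^sup>2) \<le> R" for i
          unfolding R_def by (rule shifted_sum_le) (auto simp: residual_def high)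
      qed simp
      also have "\<dots> = (D * (2 * real N))\<^sup>2 * R"
        by (simp add: power2_eq_square)
      finally show ?thesis .
    qed
    \<comment> \<open>The squared form of the triangle inequality; the weight \<open>\<delta>\<close> on the error term is the spectral gap.\<close>
    have pointwise: "(\<bar>t\<bar> - 1 - \<delta> / 2) * x\<^sup>2 \<le> y\<^sup>2 / 2 + z\<^sup>2 / 2 + (y - t * x + z)\<^sup>2 / (2 * \<delta>)"
      for x y z :: real
    proof -
      define w where "w = y - t * x + z"
      have "\<bar>t\<bar> * x\<^sup>2 = \<bar>(y + z - w) * x\<bar>"
        by (simp add: w_def abs_mult power2_eq_square)
      also have "\<dots> \<le> \<bar>y * x\<bar> + \<bar>z * x\<bar> + \<bar>w * x\<bar>"
        by (simp add: algebra_simps)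
      also have "\<bar>y * x\<bar> \<le> (y\<^sup>2 + x\<^sup>2) / 2"
        using sum_squares_bound[of "\<bar>y\<bar>" "\<bar>x\<bar>"] by (simp add: abs_mult)
      also have "\<bar>z * x\<bar> \<le> (z\<^sup>2 + x\<^sup>2) / 2"
        using sum_squares_bound[of "\<bar>z\<bar>" "\<bar>x\<bar>"] by (simp add: abs_mult)
      also have "\<bar>w * x\<bar> \<le> w\<^sup>2 / (2 * \<delta>) + \<delta> / 2 * x\<^sup>2"
      proof -
        have "2 * \<delta> * \<bar>w * x\<bar> \<le> w\<^sup>2 + \<delta>\<^sup>2 * x\<^sup>2"
          using sum_squares_bound[of "\<bar>w\<bar>" "\<delta> * \<bar>x\<bar>"]
          by (simp add: abs_mult power_mult_distrib mult.assoc mult.left_commute)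
        then show ?thesis
          using \<open>0 < \<delta>\<close> by (simp add: field_simps power2_eq_square)
      qed
      finally show ?thesis by (simp add: w_def field_simps)
    qed
    have "(\<bar>t\<bar> - 1 - \<delta> / 2) * S = (\<Sum>j<n. (\<bar>t\<bar> - 1 - \<delta> / 2) * (v (Suc j + N))\<^sup>2)"
      by (simp add: sum_distrib_left flip: shift_eq)
    also have "\<dots> \<le> (\<Sum>j<n. (v (Suc j + 2 * N))\<^sup>2 / 2 + (v (Suc j))\<^sup>2 / 2 + (e (Suc j))\<^sup>2 / (2 * \<delta>))"
      unfolding e_def by (intro sum_mono pointwise)
    also have "\<dots> = (\<Sum>j<n. (v (j + Suc (2 * N)))\<^sup>2) / 2 + (\<Sum>j<n. (v (j + Suc 0))\<^sup>2) / 2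
        + (\<Sum>j<n. (e (Suc j))\<^sup>2) / (2 * \<delta>)"
      by (simp add: sum.distrib sum_divide_distrib)
    also have "\<dots> \<le> S / 2 + S / 2 + (D * (2 * real N))\<^sup>2 * R / (2 * \<delta>)"
      using e_sq \<open>0 < \<delta>\<close> by (intro add_mono divide_right_mono shift_le) auto
    finally have "\<delta> / 2 * S \<le> (D * (2 * real N))\<^sup>2 * R / (2 * \<delta>)"
      by (simp add: \<delta>_def field_simps)
    then have "S \<le> C * R"
      using \<open>0 < \<delta>\<close> by (simp add: C_def power_divide field_simps power2_eq_square)
    then show "(\<Sum>j<n. (v j)\<^sup>2) \<le> C * (\<Sum>j<Suc n. (?r j)\<^sup>2)"
      by (simp only: S_def R_def)
  qed
qed

end

section \<open>Lower bound for the Jacobi matrix far out\<close>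

text \<open>The infinite Jacobi matrix applied to \<open>v\<close>. At \<open>j = 0\<close> the first summand is spurious; it vanishes
for \<open>v 0 = 0\<close>, the only case that occurs.\<close>

definition jacobi_apply :: "(nat \<Rightarrow> real) \<Rightarrow> (nat \<Rightarrow> real) \<Rightarrow> (nat \<Rightarrow> real) \<Rightarrow> nat \<Rightarrow> real" where
  "jacobi_apply p q v j = p (j - 1) * v (j - 1) + q j * v j + p j * v (Suc j)"

text \<open>Dividing row \<open>j\<close> of the Jacobi matrix by \<open>a j\<close> gives, up to coefficients that tend to zero, the
periodic recurrence at spectral parameter 0. Hence on sequences supported far out the lower bound of
\<open>periodic_coercive\<close> survives the perturbation, and undoing the division multiplies it by the
size of the \<open>a j\<close>. Since \<open>a\<close> tends to infinity, the constant can be made as large as desired by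
moving the support further out: the essential spectrum escapes every interval \<open>{-R..R}\<close>.\<close>

lemma tail_coercive:
  fixes N :: nat and R :: real and a b \<alpha> \<beta> :: "nat \<Rightarrow> real"
  assumes N: "1 \<le> N"
    and a_pos: "\<And>n. 0 < a n" and \<alpha>_pos: "\<And>n. 0 < \<alpha> n"
    and \<alpha>_per: "periodic_seq N \<alpha>" and \<beta>_per: "periodic_seq N \<beta>"
    and modulated: "periodically_modulated \<alpha> \<beta> a b"
    and hyperbolic: "trace (monodromy N \<alpha> \<beta> N 0) \<notin> {-2..2}"
  obtains M where "\<And>v n. (\<And>j. j \<le> M \<Longrightarrow> v j = 0) \<Longrightarrow> (\<And>j. n \<le> j \<Longrightarrow> v j = 0) \<Longrightarrow>
    (R\<^sup>2 + 1) * (\<Sum>j<n. (v j)\<^sup>2) \<le> (\<Sum>j<Suc n. (jacobi_apply a b v j)\<^sup>2)"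
proof -
  obtain C where "0 < C" and C: "\<And>v n. (\<And>j. j \<le> N \<Longrightarrow> v j = 0) \<Longrightarrow> (\<And>j. n \<le> j \<Longrightarrow> v j = 0) \<Longrightarrow>
    (\<Sum>j<n. (v j)\<^sup>2) \<le> C * (\<Sum>j<Suc n. (residual \<alpha> \<beta> v j)\<^sup>2)"
    using periodic_coercive[OF N \<alpha>_pos \<alpha>_per \<beta>_per hyperbolic] by blast
  \<comment> \<open>The estimate for \<open>r_sq\<close> below costs \<open>6 * C * \<epsilon>\<^sup>2 = 1 / 2\<close> of the squared norm, which is absorbed
    on the left; \<open>L\<close> makes the remaining constant \<open>2 * (3 * C / L\<^sup>2)\<close> equal to \<open>1 / (R\<^sup>2 + 1)\<close>.\<close>
  define \<epsilon> where "\<epsilon> = sqrt (1 / (12 * C))"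
  define L where "L = sqrt (6 * C * (R\<^sup>2 + 1))"
  have "0 < \<epsilon>" and \<epsilon>: "\<epsilon>\<^sup>2 = 1 / (12 * C)" using \<open>0 < C\<close> by (auto simp: \<epsilon>_def)
  have "0 < R\<^sup>2 + 1" by (simp add: add_nonneg_pos)
  then have "0 < L" and L: "L\<^sup>2 = 6 * C * (R\<^sup>2 + 1)" using \<open>0 < C\<close> by (auto simp: L_def)
  from modulated have "(\<lambda>n. \<bar>a (n - 1) / a n - \<alpha> (n - 1) / \<alpha> n\<bar>) \<longlonglongrightarrow> 0"
    "(\<lambda>n. \<bar>b n / a n - \<beta> n / \<alpha> n\<bar>) \<longlonglongrightarrow> 0" "filterlim a at_top sequentially"
    unfolding periodically_modulated_def by blast+
  then have "\<forall>\<^sub>F n in sequentially. \<bar>a (n - 1) / a n - \<alpha> (n - 1) / \<alpha> n\<bar> < \<epsilon> \<and>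
      \<bar>b n / a n - \<beta> n / \<alpha> n\<bar> < \<epsilon> \<and> L \<le> a n"
    using \<open>0 < \<epsilon>\<close> by (intro eventually_conj order_tendstoD(2)) (auto simp: filterlim_at_top)
  then obtain M0 where M0: "\<And>n. M0 \<le> n \<Longrightarrow> \<bar>a (n - 1) / a n - \<alpha> (n - 1) / \<alpha> n\<bar> < \<epsilon> \<and>
      \<bar>b n / a n - \<beta> n / \<alpha> n\<bar> < \<epsilon> \<and> L \<le> a n"
    unfolding eventually_sequentially by blast
  show ?thesis
  proof (rule that[of "N + M0"])
    fix v :: "nat \<Rightarrow> real" and n
    assume low: "\<And>j. j \<le> N + M0 \<Longrightarrow> v j = 0" and high: "\<And>j. n \<le> j \<Longrightarrow> v j = 0"
    let ?g = "jacobi_apply a b v" and ?r = "residual \<alpha> \<beta> v"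
    define S where "S = (\<Sum>j<n. (v j)\<^sup>2)"
    define G where "G = (\<Sum>j<Suc n. (?g j)\<^sup>2)"
    have r_sq: "(?r j)\<^sup>2 \<le> 3 / L\<^sup>2 * (?g j)\<^sup>2 + 3 * \<epsilon>\<^sup>2 * ((v j)\<^sup>2 + (v (j - 1))\<^sup>2)" for j
    proof (cases "M0 \<le> j")
      case False
      then have "?r j = 0" using N by (simp add: residual_def low)
      then show ?thesis by simp
    next
      case True
      define x where "x = ?g j / a j"
      define y where "y = (b j / a j - \<beta> j / \<alpha> j) * v j"
      define z where "z = (a (j - 1) / a j - \<alpha> (j - 1) / \<alpha> j) * v (j - 1)"
      have r: "?r j = x - y - z"
        using a_pos[of j] by (simp add: x_def y_def z_def residual_def jacobi_apply_def
            add_divide_distrib algebra_simps)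
      have sq: "(x - y - z)\<^sup>2 \<le> 3 * (x\<^sup>2 + y\<^sup>2 + z\<^sup>2)"
        using zero_le_power2[of "x + y"] zero_le_power2[of "x + z"] zero_le_power2[of "y - z"]
        by (simp add: power2_eq_square algebra_simps)
      have x: "x\<^sup>2 \<le> (?g j)\<^sup>2 / L\<^sup>2"
        unfolding x_def power_divide
        using M0[OF True] \<open>0 < L\<close> by (intro divide_left_mono power_mono) auto
      have y: "y\<^sup>2 \<le> \<epsilon>\<^sup>2 * (v j)\<^sup>2"
        unfolding y_def power_mult_distrib
        using M0[OF True] \<open>0 < \<epsilon>\<close> by (intro mult_right_mono) (auto simp: abs_le_square_iff[symmetric])
      have z: "z\<^sup>2 \<le> \<epsilon>\<^sup>2 * (v (j - 1))\<^sup>2"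
        unfolding z_def power_mult_distrib
        using M0[OF True] \<open>0 < \<epsilon>\<close> by (intro mult_right_mono) (auto simp: abs_le_square_iff[symmetric])
      note sq
      also have "3 * (x\<^sup>2 + y\<^sup>2 + z\<^sup>2)
          \<le> 3 * ((?g j)\<^sup>2 / L\<^sup>2 + \<epsilon>\<^sup>2 * (v j)\<^sup>2 + \<epsilon>\<^sup>2 * (v (j - 1))\<^sup>2)"
        by (intro mult_left_mono add_mono x y z) simp
      finally show ?thesis by (simp add: r algebra_simps)
    qed
    have S0: "(\<Sum>j<Suc n. (v j)\<^sup>2) = S" by (simp add: S_def high)
    have "(\<Sum>j<Suc n. (v (j - 1))\<^sup>2) = S"
      unfolding S_def by (subst sum.lessThan_Suc_shift) (simp add: low)
    with S0 have "(\<Sum>j<Suc n. 3 / L\<^sup>2 * (?g j)\<^sup>2 + 3 * \<epsilon>\<^sup>2 * ((v j)\<^sup>2 + (v (j - 1))\<^sup>2))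
        = 3 / L\<^sup>2 * G + 3 * \<epsilon>\<^sup>2 * (S + S)"
      unfolding G_def sum.distrib sum_distrib_left[symmetric] by simp
    moreover have "(\<Sum>j<Suc n. (?r j)\<^sup>2)
        \<le> (\<Sum>j<Suc n. 3 / L\<^sup>2 * (?g j)\<^sup>2 + 3 * \<epsilon>\<^sup>2 * ((v j)\<^sup>2 + (v (j - 1))\<^sup>2))"
      by (intro sum_mono r_sq)
    moreover have "S \<le> C * (\<Sum>j<Suc n. (?r j)\<^sup>2)"
      unfolding S_def by (rule C) (auto simp: low high)
    ultimately have "S \<le> C * (3 / L\<^sup>2 * G + 3 * \<epsilon>\<^sup>2 * (S + S))"
      using \<open>0 < C\<close> by (smt (verit) mult_left_mono)
    also have "\<dots> = G / (2 * (R\<^sup>2 + 1)) + S / 2"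
    proof -
      have "C * (3 / (6 * C * q) * G + 3 * (1 / (12 * C)) * (S + S)) = G / (2 * q) + S / 2"
        if "0 < q" for q
        using \<open>0 < C\<close> that by (simp add: field_simps)
      then show ?thesis using \<open>0 < R\<^sup>2 + 1\<close> unfolding \<epsilon> L by blast
    qed
    finally have "(R\<^sup>2 + 1) * S \<le> G"
      using \<open>0 < R\<^sup>2 + 1\<close> by (simp add: field_simps)
    then show "(R\<^sup>2 + 1) * (\<Sum>j<n. (v j)\<^sup>2) \<le> (\<Sum>j<Suc n. (?g j)\<^sup>2)"
      by (simp only: S_def G_def)
  qed
qed

section \<open>Counting eigenvalues of the truncations\<close>

text \<open>Fewer homogeneous equations than unknowns: Gaussian elimination of one unknown per equation.\<close>

lemma underdetermined_system:
  fixes f :: "'i \<Rightarrow> 'y \<Rightarrow> real"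
  assumes "finite I" "finite S" "card I < card S"
  obtains c where "\<exists>y\<in>S. c y \<noteq> 0" "\<And>i. i \<in> I \<Longrightarrow> (\<Sum>y\<in>S. c y * f i y) = 0"
proof -
  have "\<exists>c. (\<exists>y\<in>S. c y \<noteq> 0) \<and> (\<forall>i\<in>I. (\<Sum>y\<in>S. c y * f i y) = 0)"
    using assms
  proof (induction I arbitrary: S f rule: finite_induct)
    case empty
    then have "S \<noteq> {}" by auto
    then show ?case by (intro exI[of _ "\<lambda>_. 1"]) auto
  next
    case (insert k I)
    show ?case
    proof (cases "\<forall>y\<in>S. f k y = 0")
      case True
      then have "(\<Sum>y\<in>S. c y * f k y) = 0" for c by (intro sum.neutral) auto
      moreover have "\<exists>c. (\<exists>y\<in>S. c y \<noteq> 0) \<and> (\<forall>i\<in>I. (\<Sum>y\<in>S. c y * f i y) = 0)"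
        using insert by (intro insert.IH) auto
      ultimately show ?thesis by auto
    next
      case False
      then obtain z where z: "z \<in> S" "f k z \<noteq> 0" by blast
      define g where "g i y = f i y - f i z / f k z * f k y" for i y
      have "card I < card (S - {z})" using insert z by simp
      then obtain c where c: "\<exists>y\<in>S - {z}. c y \<noteq> 0"
        "\<And>i. i \<in> I \<Longrightarrow> (\<Sum>y\<in>S - {z}. c y * g i y) = 0"
        using insert.IH[of "S - {z}" g] insert.prems by auto
      define s where "s = (\<Sum>y\<in>S - {z}. c y * f k y)"
      define d where "d = c(z := - s / f k z)"
      have split: "(\<Sum>y\<in>S. d y * f i y) = - s / f k z * f i z + (\<Sum>y\<in>S - {z}. c y * f i y)" for i
        using z insert.prems by (subst sum.remove[of S z]) (auto simp: d_def intro!: sum.cong)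
      have "(\<Sum>y\<in>S. d y * f k y) = 0" using z by (simp add: split s_def)
      moreover have "(\<Sum>y\<in>S. d y * f i y) = 0" if "i \<in> I" for i
      proof -
        have "(\<Sum>y\<in>S - {z}. c y * g i y) = (\<Sum>y\<in>S - {z}. c y * f i y) - f i z / f k z * s"
          by (simp add: g_def s_def right_diff_distrib sum_subtractf sum_distrib_left ac_simps)
        then show ?thesis using c(2)[OF that] by (simp add: split mult.commute)
      qed
      moreover have "\<exists>y\<in>S. d y \<noteq> 0" using c(1) by (auto simp: d_def)
      ultimately show ?thesis by blast
    qed
  qed
  then show ?thesis using that by blast
qed

text \<open>Eigenvectors of a symmetric matrix for different eigenvalues are orthogonal. So a nontrivial
combination of eigenvectors is nonzero, and the matrix stretches it at most by a common bound for
the absolute values of the eigenvalues involved.\<close>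

lemma spectral_combination:
  fixes e :: "nat \<Rightarrow> nat \<Rightarrow> real" and u :: "real \<Rightarrow> nat \<Rightarrow> real"
  assumes sym: "\<And>i j. e i j = e j i"
    and "finite S" and S: "\<And>y. y \<in> S \<Longrightarrow> \<bar>y\<bar> \<le> R"
    and eig: "\<And>y j. y \<in> S \<Longrightarrow> j < n \<Longrightarrow> (\<Sum>i<n. e j i * u y i) = y * u y j"
    and nz: "\<And>y. y \<in> S \<Longrightarrow> \<exists>j<n. u y j \<noteq> 0"
    and c: "\<exists>y\<in>S. c y \<noteq> 0"
  defines "v \<equiv> \<lambda>j. \<Sum>y\<in>S. c y * u y j"
  shows "0 < (\<Sum>j<n. (v j)\<^sup>2)"
    and "(\<Sum>j<n. (\<Sum>i<n. e j i * v i)\<^sup>2) \<le> R\<^sup>2 * (\<Sum>j<n. (v j)\<^sup>2)"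
proof -
  have orth: "(\<Sum>j<n. u y j * u z j) = 0" if "y \<in> S" "z \<in> S" "y \<noteq> z" for y z
  proof -
    have "y * (\<Sum>j<n. u y j * u z j) = (\<Sum>j<n. (\<Sum>i<n. e j i * u y i) * u z j)"
      by (simp add: sum_distrib_left eig that ac_simps)
    also have "\<dots> = (\<Sum>i<n. (\<Sum>j<n. e i j * u z j) * u y i)"
      unfolding sum_distrib_right by (subst sum.swap) (simp add: ac_simps sym)
    also have "\<dots> = z * (\<Sum>j<n. u y j * u z j)"
      by (simp add: sum_distrib_left eig that ac_simps)
    finally show ?thesis using that by simp
  qed
  have parseval: "(\<Sum>j<n. (\<Sum>y\<in>S. d y * u y j)\<^sup>2) = (\<Sum>y\<in>S. (d y)\<^sup>2 * (\<Sum>j<n. (u y j)\<^sup>2))" for d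
  proof -
    have "(\<Sum>j<n. (\<Sum>y\<in>S. d y * u y j)\<^sup>2)
        = (\<Sum>j<n. \<Sum>y\<in>S. \<Sum>z\<in>S. d y * d z * (u y j * u z j))"
      by (simp add: power2_eq_square sum_product ac_simps)
    also have "\<dots> = (\<Sum>y\<in>S. \<Sum>j<n. \<Sum>z\<in>S. d y * d z * (u y j * u z j))"
      by (rule sum.swap)
    also have "\<dots> = (\<Sum>y\<in>S. \<Sum>z\<in>S. \<Sum>j<n. d y * d z * (u y j * u z j))"
      by (rule sum.cong[OF refl], rule sum.swap)
    also have "\<dots> = (\<Sum>y\<in>S. \<Sum>z\<in>S. if z = y then (d y)\<^sup>2 * (\<Sum>j<n. (u y j)\<^sup>2) else 0)"
      by (intro sum.cong refl) (auto simp: orth power2_eq_square simp flip: sum_distrib_left)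
    finally show ?thesis using \<open>finite S\<close> by simp
  qed
  have v_sq: "(\<Sum>j<n. (v j)\<^sup>2) = (\<Sum>y\<in>S. (c y)\<^sup>2 * (\<Sum>j<n. (u y j)\<^sup>2))"
    unfolding v_def by (rule parseval)
  have u_pos: "0 < (\<Sum>j<n. (u y j)\<^sup>2)" if "y \<in> S" for y
    using nz[OF that] by (auto intro: sum_pos2)
  obtain y where y: "y \<in> S" "c y \<noteq> 0" using c by blast
  show "0 < (\<Sum>j<n. (v j)\<^sup>2)"
    unfolding v_sq
    by (rule sum_pos2[OF \<open>finite S\<close> y(1)]) (use y u_pos in \<open>auto simp: sum_nonneg\<close>)
  have "(\<Sum>i<n. e j i * v i) = (\<Sum>y\<in>S. (c y * y) * u y j)" if "j < n" for j
  proof -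
    have "(\<Sum>i<n. e j i * v i) = (\<Sum>y\<in>S. c y * (\<Sum>i<n. e j i * u y i))"
      unfolding v_def sum_distrib_left by (subst sum.swap) (simp add: ac_simps)
    then show ?thesis using that by (simp add: eig mult.assoc)
  qed
  then have "(\<Sum>j<n. (\<Sum>i<n. e j i * v i)\<^sup>2) = (\<Sum>y\<in>S. (c y * y)\<^sup>2 * (\<Sum>j<n. (u y j)\<^sup>2))"
    by (simp add: parseval)
  also have "\<dots> \<le> (\<Sum>y\<in>S. R\<^sup>2 * ((c y)\<^sup>2 * (\<Sum>j<n. (u y j)\<^sup>2)))"
  proof (rule sum_mono)
    fix y assume "y \<in> S"
    then have "y\<^sup>2 \<le> R\<^sup>2"
      using S[of y] by (subst abs_le_square_iff[symmetric]) auto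
    then have "y\<^sup>2 * ((c y)\<^sup>2 * (\<Sum>j<n. (u y j)\<^sup>2)) \<le> R\<^sup>2 * ((c y)\<^sup>2 * (\<Sum>j<n. (u y j)\<^sup>2))"
      by (rule mult_right_mono) (auto simp: sum_nonneg)
    then show "(c y * y)\<^sup>2 * (\<Sum>j<n. (u y j)\<^sup>2) \<le> R\<^sup>2 * ((c y)\<^sup>2 * (\<Sum>j<n. (u y j)\<^sup>2))"
      by (simp add: power_mult_distrib ac_simps)
  qed
  finally show "(\<Sum>j<n. (\<Sum>i<n. e j i * v i)\<^sup>2) \<le> R\<^sup>2 * (\<Sum>j<n. (v j)\<^sup>2)"
    by (simp add: v_sq sum_distrib_left)
qed

lemma jacobi_entry_sym: "jacobi_entry a b i j = jacobi_entry a b j i"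
  by (simp add: jacobi_entry_def)

lemma sum_jacobi_entry:
  assumes "v 0 = 0" "\<And>i. n \<le> i \<Longrightarrow> v i = 0" "j < n"
  shows "(\<Sum>i<n. jacobi_entry a b j i * v i) = jacobi_apply a b v j"
proof -
  have "(\<Sum>i<n. jacobi_entry a b j i * v i) = (\<Sum>i\<in>{j - 1, j, Suc j}. jacobi_entry a b j i * v i)"
    by (rule sum.mono_neutral_cong)
      (use assms in \<open>auto simp: jacobi_entry_def not_less\<close>)
  also have "\<dots> = jacobi_apply a b v j"
    using assms by (cases j) (auto simp: jacobi_entry_def jacobi_apply_def)
  finally show ?thesis .
qed

lemma spectrum_jacobi_truncE:
  assumes "y \<in> spectrum (jacobi_trunc a b n)"
  obtains u where "\<And>j. j < n \<Longrightarrow> (\<Sum>i<n. jacobi_entry a b j i * u i) = y * u j"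
    "\<exists>j<n. u j \<noteq> 0"
proof -
  obtain x where x: "x \<in> carrier_vec n" "x \<noteq> 0\<^sub>v n" "jacobi_trunc a b n *\<^sub>v x = y \<cdot>\<^sub>v x"
    using assms by (auto simp: spectrum_def eigenvalue_def eigenvector_def jacobi_trunc_def)
  show ?thesis
  proof (rule that[of "vec_index x"])
    fix j assume "j < n"
    then have "vec_index (jacobi_trunc a b n *\<^sub>v x) j = (\<Sum>i<n. jacobi_entry a b j i * vec_index x i)"
      using x(1) by (auto simp: jacobi_trunc_def scalar_prod_def atLeast0LessThan intro!: sum.cong)
    then show "(\<Sum>i<n. jacobi_entry a b j i * vec_index x i) = y * vec_index x j"
      using x \<open>j < n\<close> by simp
  next
    show "\<exists>j<n. vec_index x j \<noteq> 0"
      using x(1,2) by (metis carrier_vecD eq_vecI index_zero_vec)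
  qed
qed

text \<open>The space spanned by the eigenvectors with eigenvalue in \<open>{-R..R}\<close> has dimension equal to the number
of these eigenvalues. If that exceeded \<open>M + 2\<close>, the space would contain a nonzero vector vanishing
on \<open>{..M}\<close> and at \<open>n - 1\<close>; on it the matrix would be bounded by \<open>R\<close> from above and by
\<open>sqrt (R\<^sup>2 + 1)\<close> from below. The zero at \<open>n - 1\<close> makes the truncated matrix act on the vector
as the infinite one does, so that the truncation costs one dimension only.\<close>

lemma card_spectrum_le:
  assumes M: "\<And>v n. (\<And>j. j \<le> M \<Longrightarrow> v j = 0) \<Longrightarrow> (\<And>j. n \<le> j \<Longrightarrow> v j = 0) \<Longrightarrow>
    (R\<^sup>2 + 1) * (\<Sum>j<n. (v j)\<^sup>2) \<le> (\<Sum>j<Suc n. (jacobi_apply a b v j)\<^sup>2)"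
  shows "card (spectrum (jacobi_trunc a b n) \<inter> {-R..R}) \<le> M + 2"
proof (rule ccontr)
  define S where "S = spectrum (jacobi_trunc a b n) \<inter> {-R..R}"
  assume "\<not> card (spectrum (jacobi_trunc a b n) \<inter> {-R..R}) \<le> M + 2"
  then have card: "M + 2 < card S" by (simp add: S_def)
  have "finite S" by (simp add: S_def finite_spectrum_jacobi_trunc)
  have "\<forall>y\<in>S. \<exists>u. (\<forall>j<n. (\<Sum>i<n. jacobi_entry a b j i * u i) = y * u j) \<and> (\<exists>j<n. u j \<noteq> 0)"
    by (auto simp: S_def elim!: spectrum_jacobi_truncE)
  then obtain u where
    u: "\<And>y j. y \<in> S \<Longrightarrow> j < n \<Longrightarrow> (\<Sum>i<n. jacobi_entry a b j i * u y i) = y * u y j"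
      "\<And>y. y \<in> S \<Longrightarrow> \<exists>j<n. u y j \<noteq> 0"
    by (metis (no_types))
  have "card (insert (n - 1) {..M}) < card S"
    using card card_insert_le_m1[of "M + 2" "{..M}" "n - 1"] by simp
  then obtain c where c: "\<exists>y\<in>S. c y \<noteq> 0"
    and c0: "\<And>i. i \<in> insert (n - 1) {..M} \<Longrightarrow> (\<Sum>y\<in>S. c y * u y i) = 0"
    using underdetermined_system[of "insert (n - 1) {..M}" S "\<lambda>i y. u y i"] \<open>finite S\<close> by auto
  define w where "w j = (\<Sum>y\<in>S. c y * u y j)" for j
  define v where "v j = (if j < n then w j else 0)" for j
  have low: "v j = 0" if "j \<le> M" for j using c0[of j] that by (simp add: v_def w_def)
  have last: "v (n - 1) = 0" using c0[of "n - 1"] by (simp add: v_def w_def)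
  have high: "v j = 0" if "n \<le> j" for j using that by (simp add: v_def)
  have S_le: "\<And>y. y \<in> S \<Longrightarrow> \<bar>y\<bar> \<le> R" by (auto simp: S_def)
  note comb = spectral_combination[OF jacobi_entry_sym \<open>finite S\<close> S_le u c, folded w_def]
  have v_w: "(\<Sum>j<n. (w j)\<^sup>2) = (\<Sum>j<n. (v j)\<^sup>2)"
    "(\<Sum>j<n. (\<Sum>i<n. jacobi_entry a b j i * w i)\<^sup>2) = (\<Sum>j<n. (\<Sum>i<n. jacobi_entry a b j i * v i)\<^sup>2)"
    by (simp_all add: v_def)
  have lower: "(R\<^sup>2 + 1) * (\<Sum>j<n. (v j)\<^sup>2) \<le> (\<Sum>j<Suc n. (jacobi_apply a b v j)\<^sup>2)"
    by (rule M) (simp_all add: low high)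
  \<comment> \<open>Row \<open>n\<close> of the infinite matrix meets \<open>v\<close> only in the entry \<open>v (n - 1)\<close>, which is zero.\<close>
  have "(\<Sum>j<Suc n. (jacobi_apply a b v j)\<^sup>2) = (\<Sum>j<n. (jacobi_apply a b v j)\<^sup>2)"
    using last high by (simp add: jacobi_apply_def)
  also have "\<dots> = (\<Sum>j<n. (\<Sum>i<n. jacobi_entry a b j i * v i)\<^sup>2)"
    using low[of 0] high by (intro sum.cong refl) (simp add: sum_jacobi_entry)
  also have "\<dots> \<le> R\<^sup>2 * (\<Sum>j<n. (v j)\<^sup>2)"
    using comb(2) v_w by simp
  finally have "(R\<^sup>2 + 1) * (\<Sum>j<n. (v j)\<^sup>2) \<le> R\<^sup>2 * (\<Sum>j<n. (v j)\<^sup>2)"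
    by (rule order_trans[OF lower])
  moreover have "0 < (\<Sum>j<n. (v j)\<^sup>2)" using comb(1) v_w by simp
  ultimately show False by (simp add: algebra_simps)
qed

section \<open>Vague convergence\<close>

theorem theorem2:
  fixes N :: nat and a b \<alpha> \<beta> :: "nat \<Rightarrow> real"
  assumes "N \<ge> 1"
    and "\<And>n. a n > 0"
    and "\<And>n. \<alpha> n > 0"
    and "periodic_seq N \<alpha>" and "periodic_seq N \<beta>"
    and "periodically_modulated \<alpha> \<beta> a b"
    and "trace (monodromy N \<alpha> \<beta> N 0) \<notin> {-2..2}"
    and "(\<lambda>n. a (n - 1) / a n) \<in> D1 N"
    and "(\<lambda>n. b n / a n) \<in> D1 N"
    and "(\<lambda>n. 1 / a n) \<in> D1 N"
  shows "\<forall>\<rho>::nat \<Rightarrow> real. (\<forall>n. \<rho> n > 0) \<longrightarrow> filterlim \<rho> at_top sequentially \<longrightarrow>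
    vaguely_converges (\<lambda>n. scale_measure (ennreal (1 / \<rho> n)) (eigenvalue_measure a b n))
      (null_measure borel)"
proof (intro allI impI)
  fix \<rho> :: "nat \<Rightarrow> real"
  assume pos: "\<forall>n. \<rho> n > 0" and lim: "filterlim \<rho> at_top sequentially"
  show "vaguely_converges (\<lambda>n. scale_measure (ennreal (1 / \<rho> n)) (eigenvalue_measure a b n))
      (null_measure borel)"
    unfolding vaguely_converges_null_iff[OF pos[rule_format]]
  proof (intro allI impI)
    fix f :: "real \<Rightarrow> real"
    assume cont: "continuous_on UNIV f" and comp: "compact (closure {x. f x \<noteq> 0})"
    obtain R where R: "\<And>x. x \<in> closure {x. f x \<noteq> 0} \<Longrightarrow> \<bar>x\<bar> \<le> R"
      using compact_imp_bounded[OF comp] by (auto simp: bounded_iff)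
    have f0: "f x = 0" if "x \<notin> {-R..R}" for x
      using R[of x] closure_subset[of "{x. f x \<noteq> 0}"] that by auto
    have "compact (f ` {-R..R})"
      by (intro compact_continuous_image continuous_on_subset[OF cont]) auto
    then obtain B where B: "\<forall>x\<in>{-R..R}. \<bar>f x\<bar> \<le> B"
      using compact_imp_bounded[of "f ` {-R..R}"] by (auto simp: bounded_iff)
    obtain M where M: "\<And>v n. (\<And>j. j \<le> M \<Longrightarrow> v j = 0) \<Longrightarrow> (\<And>j. n \<le> j \<Longrightarrow> v j = 0) \<Longrightarrow>
        (R\<^sup>2 + 1) * (\<Sum>j<n. (v j)\<^sup>2) \<le> (\<Sum>j<Suc n. (jacobi_apply a b v j)\<^sup>2)"
      using tail_coercive[OF assms(1-7)] by blast
    have "\<bar>integral\<^sup>L (eigenvalue_measure a b n) f\<bar> \<le> real (M + 2) * \<bar>B\<bar>" for n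
    proof -
      let ?S = "spectrum (jacobi_trunc a b (n + 1))"
      have card: "card (?S \<inter> {-R..R}) \<le> M + 2"
        by (rule card_spectrum_le) (rule M)
      have "integral\<^sup>L (eigenvalue_measure a b n) f = (\<Sum>y\<in>?S. f y)"
        by (intro integral_eigenvalue_measure borel_measurable_continuous_onI cont)
      also have "\<dots> = (\<Sum>y\<in>?S \<inter> {-R..R}. f y)"
        by (rule sum.mono_neutral_right) (auto simp: finite_spectrum_jacobi_trunc f0)
      also have "\<bar>\<dots>\<bar> \<le> (\<Sum>y\<in>?S \<inter> {-R..R}. \<bar>B\<bar>)"
        by (intro order_trans[OF sum_abs] sum_mono order_trans[OF B[rule_format]]) auto
      also have "\<dots> \<le> real (M + 2) * \<bar>B\<bar>"
        using card
        by (simp only: sum_constant of_nat_le_iff mult_right_mono abs_ge_zero)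
      finally show ?thesis .
    qed
    then have bd: "norm (1 / \<rho> n * integral\<^sup>L (eigenvalue_measure a b n) f)
        \<le> real (M + 2) * \<bar>B\<bar> / \<rho> n" for n
      using pos[rule_format, of n] by (simp add: abs_mult divide_right_mono)
    show "(\<lambda>n. 1 / \<rho> n * integral\<^sup>L (eigenvalue_measure a b n) f) \<longlonglongrightarrow> 0"
    proof (rule Lim_null_comparison[OF always_eventually[OF allI[OF bd]]])
      show "(\<lambda>n. real (M + 2) * \<bar>B\<bar> / \<rho> n) \<longlonglongrightarrow> 0"
        by (rule tendsto_divide_0[OF tendsto_const filterlim_at_top_imp_at_infinity[OF lim]])
    qed
  qed
qed

end
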